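(* Let $(X,\cdot,d)$ be a complete metric invariant group and let $a\in X$. Let $f$ and $g$ be two lower semicontinuous functions on $(X,d)$. Then the following assertions are equivalent. (I) The map $x\mapsto (f\oplus g)(x)$ has a strong minimum at $a$. (II) There exists $(\tilde y,\tilde z)\in X\times X$ such that $\tilde y\tilde z=a$, $f$ has a strong minimum at $\tilde y$, and $g$ has a strong minimum at $\tilde z$.
   Context: A group $(X,\cdot)$ with a metric $d$ is metric invariant if $d(xy,xz)=d(yx,zx)=d(y,z)$ for all $x,y,z\in X$; it is complete if $(X,d)$ is a complete metric space. Functions on $X$ take values in $\mathbb{R}\cup\{+\infty\}$, and $f$, $g$ are assumed to have nonempty domain, where $dom(f)=\{x\in X: f(x)<+\infty\}$. The inf-convolution is $(f\oplus g)(x):=\inf\{f(y)+g(z): y,z\in X,\ yz=x\}$, $x\in X$. A function $h$ on a metric space $(X,d)$ has a strong minimum at $x_0\in X$ if $\inf_X h=h(x_0)$ (with $h(x_0)$ a real number) and for every $\epsilon>0$ there exists $\delta>0$ such that $0\le h(x)-h(x_0)\le\delta$ implies $d(x,x_0)\le\epsilon$. *)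

theory Defs
  imports "HOL-Algebra.Group" "HOL-Analysis.Analysis"
begin

text \<open>
  Functions with values in \<open>\<real> \<union> {+\<infinity>}\<close> are rendered as \<open>ereal\<close>-valued functions that map the
  carrier into \<open>{-\<infinity><..}\<close>; only their values on the carrier matter. The inf-convolution of two such
  functions may take the value \<open>-\<infinity>\<close>, so the notions below are defined for arbitrary
  \<open>ereal\<close>-valued functions.
\<close>

locale metric_invariant_group = group G + Metric_space "carrier G" d
  for G (structure) and d +
  assumes left_invariant:
    "\<lbrakk>x \<in> carrier G; y \<in> carrier G; z \<in> carrier G\<rbrakk> \<Longrightarrow> d (x \<otimes> y) (x \<otimes> z) = d y z"
  and right_invariant:
    "\<lbrakk>x \<in> carrier G; y \<in> carrier G; z \<in> carrier G\<rbrakk> \<Longrightarrow> d (y \<otimes> x) (z \<otimes> x) = d y z"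

definition effective_domain :: "'a set \<Rightarrow> ('a \<Rightarrow> ereal) \<Rightarrow> 'a set"
  where "effective_domain M f = {x \<in> M. f x < \<infinity>}"

definition lower_semicontinuous_map :: "'a topology \<Rightarrow> ('a \<Rightarrow> ereal) \<Rightarrow> bool"
  where "lower_semicontinuous_map X f \<longleftrightarrow>
    (\<forall>r::real. openin X {x \<in> topspace X. ereal r < f x})"

definition inf_convolution ::
    "('a, 'b) monoid_scheme \<Rightarrow> ('a \<Rightarrow> ereal) \<Rightarrow> ('a \<Rightarrow> ereal) \<Rightarrow> 'a \<Rightarrow> ereal"
  where "inf_convolution G f g x =
    Inf {f y + g z | y z. y \<in> carrier G \<and> z \<in> carrier G \<and> y \<otimes>\<^bsub>G\<^esub> z = x}"

text \<open>
  The condition \<open>\<bar>h x0\<bar> \<noteq> \<infinity>\<close> says that \<open>h x0\<close> is a real number; the difference \<open>h x - h x0\<close>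
  is then never of the form \<open>\<infinity> - \<infinity>\<close>.
\<close>

definition (in Metric_space) strong_minimum_at :: "('a \<Rightarrow> ereal) \<Rightarrow> 'a \<Rightarrow> bool"
  where "strong_minimum_at h x0 \<longleftrightarrow>
    x0 \<in> M \<and> \<bar>h x0\<bar> \<noteq> \<infinity> \<and> (INF x\<in>M. h x) = h x0 \<and>
    (\<forall>\<epsilon>::real>0. \<exists>\<delta>::real>0. \<forall>x\<in>M.
      0 \<le> h x - h x0 \<and> h x - h x0 \<le> ereal \<delta> \<longrightarrow> d x x0 \<le> \<epsilon>)"

end

theory Submission
  imports Defs
begin

text \<open>
  The infimum of \<open>f \<oplus> g\<close> is \<open>inf f + inf g\<close>, and near-minimisers \<open>y\<close> of \<open>f\<close>, \<open>z\<close> of \<open>g\<close> yield a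
  near-minimiser \<open>y \<otimes> z\<close> of \<open>f \<oplus> g\<close>. If the latter has a strong minimum at \<open>a\<close>, two near-minimisers
  \<open>y\<close>, \<open>y'\<close> of \<open>f\<close> satisfy \<open>d y y' = d (y \<otimes> z) (y' \<otimes> z)\<close>, which is small because both products are
  close to \<open>a\<close>. So the sublevel sets of \<open>f\<close>, which are closed by semicontinuity, have diameters
  shrinking to \<open>0\<close>, and Cantor's intersection theorem gives a strong minimum of \<open>f\<close>; likewise for
  \<open>g\<close>. Conversely, a near-minimiser of \<open>f \<oplus> g\<close> factors into near-minimisers of \<open>f\<close> and \<open>g\<close>, and
  invariance makes the product jointly non-expansive.
\<close>

section \<open>Strong minima and sublevel sets in a metric space\<close>

context Metric_space
begin

text \<open>Naming the minimal value as a real \<open>m\<close> removes extended subtraction: since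
  \<open>m\<close> bounds \<open>h\<close> from below, the two-sided condition on
  \<open>h x - h x0\<close> becomes membership of a sublevel set of \<open>h\<close>. All later
  arguments use this form.\<close>

lemma strong_minimum_at_iff:
  "strong_minimum_at h x0 \<longleftrightarrow> x0 \<in> M \<and> (\<exists>m. h x0 = ereal m \<and> (\<forall>x\<in>M. ereal m \<le> h x) \<and>
    (\<forall>\<epsilon>>0. \<exists>\<delta>>0. \<forall>x\<in>M. h x \<le> ereal (m + \<delta>) \<longrightarrow> d x x0 \<le> \<epsilon>))"
proof -
  have INF: "(INF x\<in>M. h x) = h x0 \<longleftrightarrow> (\<forall>x\<in>M. h x0 \<le> h x)" if "x0 \<in> M"
  proof
    assume "(INF x\<in>M. h x) = h x0"
    then show "\<forall>x\<in>M. h x0 \<le> h x"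
      by (metis INF_lower)
  next
    assume "\<forall>x\<in>M. h x0 \<le> h x"
    with that show "(INF x\<in>M. h x) = h x0"
      by (intro antisym INF_lower INF_greatest) auto
  qed
  have diff: "0 \<le> u - ereal m \<and> u - ereal m \<le> ereal \<delta> \<longleftrightarrow> u \<le> ereal (m + \<delta>)" if "ereal m \<le> u"
    for u m \<delta>
    using that by (cases u) auto
  show ?thesis
  proof (cases "x0 \<in> M")
    case True
    show ?thesis
    proof (cases "h x0")
      case (real m)
      show ?thesis
        unfolding strong_minimum_at_def INF [OF True] using True diff
        by (auto simp: real)
    qed (simp_all add: strong_minimum_at_def)
  qed (simp add: strong_minimum_at_def)
qed

lemma strong_minimum_at_imp_mem: "strong_minimum_at h x0 \<Longrightarrow> x0 \<in> M"
  by (simp add: strong_minimum_at_def)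

lemma closedin_sublevel_set:
  assumes "lower_semicontinuous_map mtopology f"
  shows "closedin mtopology {x \<in> M. f x \<le> ereal r}"
proof -
  have "M - {x \<in> M. f x \<le> ereal r} = {x \<in> M. ereal r < f x}"
    by auto
  with assms show ?thesis
    by (simp add: closedin_def lower_semicontinuous_map_def)
qed

text \<open>Cantor's theorem for sublevel sets at heights decreasing to \<open>m\<close>:
  \<open>approx\<close> makes them nonempty, \<open>lsc\<close> closed, and \<open>small\<close>
  shrinks them. A common point has value \<open>m\<close> by \<open>lower\<close>.\<close>

lemma strong_minimum_exists:
  assumes "mcomplete"
    and lsc: "lower_semicontinuous_map mtopology f"
    and lower: "\<And>x. x \<in> M \<Longrightarrow> ereal m \<le> f x"
    and approx: "\<And>\<delta>. \<delta> > 0 \<Longrightarrow> \<exists>x\<in>M. f x \<le> ereal (m + \<delta>)"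
    and small: "\<And>\<epsilon>. \<epsilon> > 0 \<Longrightarrow> \<exists>\<delta>>0. \<forall>x\<in>M. \<forall>x'\<in>M.
      f x \<le> ereal (m + \<delta>) \<longrightarrow> f x' \<le> ereal (m + \<delta>) \<longrightarrow> d x x' \<le> \<epsilon>"
  obtains x where "strong_minimum_at f x" "f x = ereal m"
proof -
  \<comment> \<open>Heights strictly above \<open>m\<close> keep every set nonempty before the value
    \<open>m\<close> is known to be attained.\<close>
  define C where "C n = {x \<in> M. f x \<le> ereal (m + 1 / Suc n)}" for n
  have ne: "C n \<noteq> {}" for n
    using approx [of "1 / Suc n"] by (auto simp: C_def)
  have "decseq C"
    unfolding decseq_def
  proof (intro allI impI subsetI)
    fix i j :: nat and x assume "i \<le> j" and x: "x \<in> C j"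
    then have "ereal (m + 1 / Suc j) \<le> ereal (m + 1 / Suc i)"
      by (simp add: frac_le)
    with x show "x \<in> C i"
      unfolding C_def by (blast intro: order_trans)
  qed
  \<comment> \<open>\<open>mcomplete_nest\<close> asks for containment in a small ball, not for a
    small diameter; any point of \<open>C n\<close> can be the centre.\<close>
  moreover have "\<exists>n b. C n \<subseteq> mcball b \<epsilon>" if \<epsilon>: "\<epsilon> > 0" for \<epsilon>
  proof -
    obtain \<delta> where "\<delta> > 0" and \<delta>: "\<forall>x\<in>M. \<forall>x'\<in>M.
      f x \<le> ereal (m + \<delta>) \<longrightarrow> f x' \<le> ereal (m + \<delta>) \<longrightarrow> d x x' \<le> \<epsilon>"
      using small [OF \<epsilon>] by blast
    obtain n where "1 / Suc n < \<delta>"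
      using \<open>\<delta> > 0\<close> nat_approx_posE by blast
    then have n: "ereal (m + 1 / Suc n) \<le> ereal (m + \<delta>)"
      by simp
    obtain b where b: "b \<in> C n"
      using ne by blast
    have "C n \<subseteq> mcball b \<epsilon>"
    proof
      fix x assume x: "x \<in> C n"
      have "f b \<le> ereal (m + \<delta>)" "f x \<le> ereal (m + \<delta>)"
        using b x order_trans [OF _ n] by (auto simp: C_def)
      with b x \<delta> show "x \<in> mcball b \<epsilon>"
        by (auto simp: C_def)
    qed
    then show ?thesis
      by blast
  qed
  moreover have "closedin mtopology (C n)" for n
    unfolding C_def by (rule closedin_sublevel_set [OF lsc])
  ultimately have "\<Inter> (range C) \<noteq> {}"
    using \<open>mcomplete\<close> ne unfolding mcomplete_nest by blast
  then obtain x where x: "\<And>n. x \<in> C n"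
    by blast
  then have "x \<in> M"
    by (simp add: C_def)
  have "f x \<le> ereal m + ereal e" if "e > 0" for e
  proof -
    obtain n where "1 / Suc n < e"
      using \<open>e > 0\<close> nat_approx_posE by blast
    moreover have "f x \<le> ereal (m + 1 / Suc n)"
      using x [of n] by (simp add: C_def)
    ultimately show ?thesis
      by (cases "f x") auto
  qed
  then have "f x \<le> ereal m"
    by (simp add: ereal_le_epsilon2)
  then have fx: "f x = ereal m"
    using lower [OF \<open>x \<in> M\<close>] by (rule antisym)
  \<comment> \<open>As \<open>f x = ereal m\<close>, the point \<open>x\<close> lies in every
    sublevel set, so it can be the second point in \<open>small\<close>.\<close>
  have "\<exists>\<delta>>0. \<forall>y\<in>M. f y \<le> ereal (m + \<delta>) \<longrightarrow> d y x \<le> \<epsilon>" if \<epsilon>: "\<epsilon> > 0" for \<epsilon>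
  proof -
    obtain \<delta> where "\<delta> > 0" and \<delta>: "\<forall>x\<in>M. \<forall>x'\<in>M.
      f x \<le> ereal (m + \<delta>) \<longrightarrow> f x' \<le> ereal (m + \<delta>) \<longrightarrow> d x x' \<le> \<epsilon>"
      using small [OF \<epsilon>] by blast
    with fx \<open>x \<in> M\<close> show ?thesis
      by (intro exI [of _ \<delta>]) auto
  qed
  then have "strong_minimum_at f x"
    using \<open>x \<in> M\<close> fx lower by (auto simp: strong_minimum_at_iff)
  with fx show thesis
    by (rule that [rotated])
qed

end

section \<open>Inf-convolution and extended-real estimates\<close>

lemma inf_convolution_le:
  assumes "y \<in> carrier G" "z \<in> carrier G"
  shows "inf_convolution G f g (y \<otimes>\<^bsub>G\<^esub> z) \<le> f y + g z"
  unfolding inf_convolution_def using assms by (intro Inf_lower) blast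

lemma inf_convolution_ge:
  assumes "\<And>y z. \<lbrakk>y \<in> carrier G; z \<in> carrier G; y \<otimes>\<^bsub>G\<^esub> z = x\<rbrakk> \<Longrightarrow> c \<le> f y + g z"
  shows "c \<le> inf_convolution G f g x"
  unfolding inf_convolution_def using assms by (intro Inf_greatest) blast

lemma inf_convolution_less_obtain:
  assumes "inf_convolution G f g x < c"
  obtains y z where "y \<in> carrier G" "z \<in> carrier G" "y \<otimes>\<^bsub>G\<^esub> z = x" "f y + g z < c"
  using assms unfolding inf_convolution_def Inf_less_iff by blast

text \<open>The total excess over \<open>p + q\<close> is at most \<delta> and neither summand has
  negative excess, so each has excess at most \<delta>. The bounds also force both values to be
  real.\<close>

lemma ereal_add_le_cancel_bounds:
  assumes "ereal p \<le> u" "ereal q \<le> v" "u + v \<le> ereal (p + q + \<delta>)"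
  shows "u \<le> ereal (p + \<delta>)" "v \<le> ereal (q + \<delta>)"
  using assms by (cases u; cases v; simp)+

lemma ereal_add_le_half:
  assumes "u \<le> ereal (p + \<delta> / 2)" "v \<le> ereal (q + \<delta> / 2)"
  shows "u + v \<le> ereal (p + q + \<delta>)"
  using add_mono [OF assms] by (simp add: add_ac)

text \<open>The infimum is real because \<open>c\<close> bounds it below and \<open>f x0\<close>
  above. The two conclusions are the forms of \<open>lower\<close> and \<open>approx\<close> that
  \<open>strong_minimum_exists\<close> takes.\<close>

lemma finite_infimum:
  fixes f :: "'a \<Rightarrow> ereal"
  assumes "x0 \<in> S" "f x0 < \<infinity>" and lower: "\<And>x. x \<in> S \<Longrightarrow> ereal c \<le> f x"
  obtains p where "\<And>x. x \<in> S \<Longrightarrow> ereal p \<le> f x"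
    "\<And>\<delta>. \<delta> > 0 \<Longrightarrow> \<exists>x\<in>S. f x \<le> ereal (p + \<delta>)"
proof -
  have "ereal c \<le> (INF x\<in>S. f x)" "(INF x\<in>S. f x) < \<infinity>"
    using assms by (auto intro!: INF_greatest le_less_trans [OF INF_lower] simp del: ereal_infty_less)
  then obtain p where p: "(INF x\<in>S. f x) = ereal p"
    by (cases "INF x\<in>S. f x") auto
  show thesis
  proof
    show "ereal p \<le> f x" if "x \<in> S" for x
      using that by (metis INF_lower p)
    show "\<exists>x\<in>S. f x \<le> ereal (p + \<delta>)" if "\<delta> > 0" for \<delta>
    proof -
      have "(INF x\<in>S. f x) < ereal (p + \<delta>)"
        using that p by simp
      then show ?thesis
        by (auto simp: INF_less_iff intro: less_imp_le)
    qed
  qed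
qed

section \<open>The two implications in an invariant group\<close>

context metric_invariant_group
begin

text \<open>Passing through \<open>y \<otimes> z'\<close>, left invariance cancels \<open>y\<close>
  in one term and right invariance cancels \<open>z'\<close> in the other.\<close>

lemma dist_mult_le:
  assumes "y \<in> carrier G" "z \<in> carrier G" "y' \<in> carrier G" "z' \<in> carrier G"
  shows "d (y \<otimes> z) (y' \<otimes> z') \<le> d y y' + d z z'"
proof -
  have "d (y \<otimes> z) (y' \<otimes> z') \<le> d (y \<otimes> z) (y \<otimes> z') + d (y \<otimes> z') (y' \<otimes> z')"
    using assms by (intro triangle) auto
  then show ?thesis
    using assms by (simp add: left_invariant right_invariant)
qed

lemma strong_minimum_inf_convolution:
  assumes f: "strong_minimum_at f y" and g: "strong_minimum_at g z"
  shows "strong_minimum_at (inf_convolution G f g) (y \<otimes> z)"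
proof -
  let ?h = "inf_convolution G f g"
  obtain p where y: "y \<in> carrier G" and p: "f y = ereal p" "\<And>x. x \<in> carrier G \<Longrightarrow> ereal p \<le> f x"
    and f_near: "\<And>\<epsilon>. \<epsilon> > 0 \<Longrightarrow> \<exists>\<delta>>0. \<forall>x\<in>carrier G. f x \<le> ereal (p + \<delta>) \<longrightarrow> d x y \<le> \<epsilon>"
    using f unfolding strong_minimum_at_iff by blast
  obtain q where z: "z \<in> carrier G" and q: "g z = ereal q" "\<And>x. x \<in> carrier G \<Longrightarrow> ereal q \<le> g x"
    and g_near: "\<And>\<epsilon>. \<epsilon> > 0 \<Longrightarrow> \<exists>\<delta>>0. \<forall>x\<in>carrier G. g x \<le> ereal (q + \<delta>) \<longrightarrow> d x z \<le> \<epsilon>"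
    using g unfolding strong_minimum_at_iff by blast
  have lower: "ereal (p + q) \<le> ?h x" for x
    using add_mono [OF p(2) q(2)] by (intro inf_convolution_ge) simp
  have attained: "?h (y \<otimes> z) = ereal (p + q)"
    using inf_convolution_le [OF y z, of f g] p(1) q(1) lower by (intro antisym) auto
  have "\<exists>\<delta>>0. \<forall>x\<in>carrier G. ?h x \<le> ereal (p + q + \<delta>) \<longrightarrow> d x (y \<otimes> z) \<le> \<epsilon>"
    if "\<epsilon> > 0" for \<epsilon>
  proof -
    have "\<epsilon> / 2 > 0"
      using that by simp
    then obtain \<delta>1 where "\<delta>1 > 0"
      and \<delta>1: "\<And>x. x \<in> carrier G \<Longrightarrow> f x \<le> ereal (p + \<delta>1) \<Longrightarrow> d x y \<le> \<epsilon> / 2"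
      using f_near by blast
    obtain \<delta>2 where "\<delta>2 > 0"
      and \<delta>2: "\<And>x. x \<in> carrier G \<Longrightarrow> g x \<le> ereal (q + \<delta>2) \<Longrightarrow> d x z \<le> \<epsilon> / 2"
      using g_near \<open>\<epsilon> / 2 > 0\<close> by blast
    define \<delta> where "\<delta> = min \<delta>1 \<delta>2"
    have "\<delta> > 0"
      using \<open>\<delta>1 > 0\<close> \<open>\<delta>2 > 0\<close> by (simp add: \<delta>_def)
    \<comment> \<open>The infimum defining \<open>?h x\<close> may not be attained. Halving \<delta>
      gives a strict inequality, hence an actual factorisation of \<open>x\<close> with sum below
      \<open>p + q + \<delta>\<close>.\<close>
    have "d x (y \<otimes> z) \<le> \<epsilon>" if "?h x \<le> ereal (p + q + \<delta> / 2)" for x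
    proof -
      have "?h x < ereal (p + q + \<delta>)"
        using that \<open>\<delta> > 0\<close> by (elim le_less_trans) simp
      then obtain u v where uv: "u \<in> carrier G" "v \<in> carrier G" "u \<otimes> v = x"
        and le: "f u + g v \<le> ereal (p + q + \<delta>)"
        by (metis inf_convolution_less_obtain less_imp_le)
      note bounds = ereal_add_le_cancel_bounds [OF p(2) q(2) le, OF uv(1,2)]
      have "d u y \<le> \<epsilon> / 2"
        by (intro \<delta>1 uv(1) order_trans [OF bounds(1)]) (simp add: \<delta>_def)
      moreover have "d v z \<le> \<epsilon> / 2"
        by (intro \<delta>2 uv(2) order_trans [OF bounds(2)]) (simp add: \<delta>_def)
      ultimately show ?thesis
        using dist_mult_le [OF uv(1,2) y z] uv(3) by simp
    qed
    with \<open>\<delta> > 0\<close> show ?thesis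
      by (intro exI [of _ "\<delta> / 2"]) auto
  qed
  with lower attained y z show ?thesis
    by (auto simp: strong_minimum_at_iff)
qed

text \<open>Real infima \<open>p\<close> and \<open>q\<close> come first; then
  \<open>near_mult\<close> supplies the smallness from which \<open>strong_minimum_exists\<close>
  yields \<open>y\<close> and \<open>z\<close>, and it also identifies their product.\<close>

lemma strong_minimum_factors:
  assumes "mcomplete"
    and f: "f \<in> carrier G \<rightarrow> {-\<infinity><..}" "effective_domain (carrier G) f \<noteq> {}"
      "lower_semicontinuous_map mtopology f"
    and g: "g \<in> carrier G \<rightarrow> {-\<infinity><..}" "effective_domain (carrier G) g \<noteq> {}"
      "lower_semicontinuous_map mtopology g"
    and min: "strong_minimum_at (inf_convolution G f g) a"
  obtains y z where "y \<otimes> z = a" "strong_minimum_at f y" "strong_minimum_at g z"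
proof -
  let ?h = "inf_convolution G f g"
  obtain m where a: "a \<in> carrier G" and m: "?h a = ereal m"
    and h_ge: "\<And>x. x \<in> carrier G \<Longrightarrow> ereal m \<le> ?h x"
    and near: "\<And>\<epsilon>. \<epsilon> > 0 \<Longrightarrow> \<exists>\<delta>>0. \<forall>x\<in>carrier G. ?h x \<le> ereal (m + \<delta>) \<longrightarrow> d x a \<le> \<epsilon>"
    using min unfolding strong_minimum_at_iff by blast
  have sum_ge: "ereal m \<le> f y + g z" if "y \<in> carrier G" "z \<in> carrier G" for y z
    using that by (intro order_trans [OF h_ge inf_convolution_le]) auto
  obtain y0 where y0: "y0 \<in> carrier G" "f y0 < \<infinity>"
    using f(2) by (auto simp: effective_domain_def)
  then obtain fy0 where fy0: "f y0 = ereal fy0"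
    using f(1) by (cases "f y0") (auto simp: Pi_iff)
  obtain z0 where z0: "z0 \<in> carrier G" "g z0 < \<infinity>"
    using g(2) by (auto simp: effective_domain_def)
  then obtain gz0 where gz0: "g z0 = ereal gz0"
    using g(1) by (cases "g z0") (auto simp: Pi_iff)
  \<comment> \<open>Fixing a point where \<open>g\<close> is finite turns the lower bound
    \<open>m\<close> on sums into a real lower bound on \<open>f\<close>.\<close>
  have "ereal (m - gz0) \<le> f y" if "y \<in> carrier G" for y
    using sum_ge [OF that z0(1)] gz0 by (cases "f y") auto
  then obtain p where p: "\<And>y. y \<in> carrier G \<Longrightarrow> ereal p \<le> f y"
      "\<And>\<delta>. \<delta> > 0 \<Longrightarrow> \<exists>y\<in>carrier G. f y \<le> ereal (p + \<delta>)"
    using finite_infimum [of y0 "carrier G" f] y0 by metis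
  have "ereal (m - fy0) \<le> g z" if "z \<in> carrier G" for z
    using sum_ge [OF y0(1) that] fy0 by (cases "g z") auto
  then obtain q where q: "\<And>z. z \<in> carrier G \<Longrightarrow> ereal q \<le> g z"
      "\<And>\<delta>. \<delta> > 0 \<Longrightarrow> \<exists>z\<in>carrier G. g z \<le> ereal (q + \<delta>)"
    using finite_infimum [of z0 "carrier G" g] z0 by metis
  \<comment> \<open>This places sums close to \<open>p + q\<close> in the sublevel sets of
    \<open>?h\<close> just above \<open>m\<close>.\<close>
  have "p + q \<le> m"
  proof -
    have "ereal (p + q) \<le> ?h a"
      using add_mono [OF p(1) q(1)] by (intro inf_convolution_ge) simp
    with m show ?thesis
      by simp
  qed
  have near_mult: "\<exists>\<delta>>0. \<forall>y\<in>carrier G. \<forall>z\<in>carrier G.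
      f y \<le> ereal (p + \<delta>) \<longrightarrow> g z \<le> ereal (q + \<delta>) \<longrightarrow> d (y \<otimes> z) a \<le> \<epsilon>" if \<epsilon>: "\<epsilon> > 0" for \<epsilon>
  proof -
    obtain \<delta> where "\<delta> > 0" and \<delta>: "\<And>x. x \<in> carrier G \<Longrightarrow> ?h x \<le> ereal (m + \<delta>) \<Longrightarrow> d x a \<le> \<epsilon>"
      using near [OF \<epsilon>] by blast
    have "d (y \<otimes> z) a \<le> \<epsilon>" if yz: "y \<in> carrier G" "z \<in> carrier G"
      and le: "f y \<le> ereal (p + \<delta> / 2)" "g z \<le> ereal (q + \<delta> / 2)" for y z
    proof -
      have "?h (y \<otimes> z) \<le> f y + g z"
        by (rule inf_convolution_le [OF yz])
      also have "\<dots> \<le> ereal (p + q + \<delta>)"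
        by (rule ereal_add_le_half [OF le])
      also have "\<dots> \<le> ereal (m + \<delta>)"
        using \<open>p + q \<le> m\<close> by simp
      finally show ?thesis
        using \<delta> yz by simp
    qed
    with \<open>\<delta> > 0\<close> show ?thesis
      by (intro exI [of _ "\<delta> / 2"]) auto
  qed
  have dist_le: "d u v \<le> \<epsilon>" if "d u a \<le> \<epsilon> / 2" "d v a \<le> \<epsilon> / 2" "u \<in> carrier G" "v \<in> carrier G"
    for u v \<epsilon>
    using triangle [of u a v] commute [of a v] that a by simp
  have f_small: "\<exists>\<delta>>0. \<forall>y\<in>carrier G. \<forall>y'\<in>carrier G.
      f y \<le> ereal (p + \<delta>) \<longrightarrow> f y' \<le> ereal (p + \<delta>) \<longrightarrow> d y y' \<le> \<epsilon>" if \<epsilon>: "\<epsilon> > 0" for \<epsilon>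
  proof -
    obtain \<delta> where "\<delta> > 0" and \<delta>: "\<forall>y\<in>carrier G. \<forall>z\<in>carrier G.
      f y \<le> ereal (p + \<delta>) \<longrightarrow> g z \<le> ereal (q + \<delta>) \<longrightarrow> d (y \<otimes> z) a \<le> \<epsilon> / 2"
      using near_mult [OF half_gt_zero [OF \<epsilon>]] by blast
    \<comment> \<open>One common right factor \<open>z\<close> for both \<open>y\<close> and
      \<open>y'\<close>, so that right invariance cancels it.\<close>
    obtain z where z: "z \<in> carrier G" "g z \<le> ereal (q + \<delta>)"
      using q(2) [OF \<open>\<delta> > 0\<close>] by blast
    have "d y y' \<le> \<epsilon>" if "y \<in> carrier G" "y' \<in> carrier G"
      "f y \<le> ereal (p + \<delta>)" "f y' \<le> ereal (p + \<delta>)" for y y'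
      using dist_le [of "y \<otimes> z" \<epsilon> "y' \<otimes> z"] right_invariant [of z y y'] that z \<delta> by simp
    with \<open>\<delta> > 0\<close> show ?thesis
      by blast
  qed
  have g_small: "\<exists>\<delta>>0. \<forall>z\<in>carrier G. \<forall>z'\<in>carrier G.
      g z \<le> ereal (q + \<delta>) \<longrightarrow> g z' \<le> ereal (q + \<delta>) \<longrightarrow> d z z' \<le> \<epsilon>" if \<epsilon>: "\<epsilon> > 0" for \<epsilon>
  proof -
    obtain \<delta> where "\<delta> > 0" and \<delta>: "\<forall>y\<in>carrier G. \<forall>z\<in>carrier G.
      f y \<le> ereal (p + \<delta>) \<longrightarrow> g z \<le> ereal (q + \<delta>) \<longrightarrow> d (y \<otimes> z) a \<le> \<epsilon> / 2"
      using near_mult [OF half_gt_zero [OF \<epsilon>]] by blast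
    obtain y where y: "y \<in> carrier G" "f y \<le> ereal (p + \<delta>)"
      using p(2) [OF \<open>\<delta> > 0\<close>] by blast
    have "d z z' \<le> \<epsilon>" if "z \<in> carrier G" "z' \<in> carrier G"
      "g z \<le> ereal (q + \<delta>)" "g z' \<le> ereal (q + \<delta>)" for z z'
      using dist_le [of "y \<otimes> z" \<epsilon> "y \<otimes> z'"] left_invariant [of y z z'] that y \<delta> by simp
    with \<open>\<delta> > 0\<close> show ?thesis
      by blast
  qed
  obtain y where y: "strong_minimum_at f y" "f y = ereal p"
    using strong_minimum_exists [OF \<open>mcomplete\<close> f(3) p f_small] by blast
  obtain z where z: "strong_minimum_at g z" "g z = ereal q"
    using strong_minimum_exists [OF \<open>mcomplete\<close> g(3) q g_small] by blast
  have yz: "y \<in> carrier G" "z \<in> carrier G"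
    using y(1) z(1) by (simp_all add: strong_minimum_at_imp_mem)
  \<comment> \<open>Exact minimisers lie in the sublevel sets for every \<delta>, so
    \<open>near_mult\<close> bounds this distance by every positive \<epsilon>.\<close>
  have "d (y \<otimes> z) a \<le> \<epsilon>" if \<epsilon>: "\<epsilon> > 0" for \<epsilon>
  proof -
    obtain \<delta> where "\<delta> > 0" and \<delta>: "\<forall>y\<in>carrier G. \<forall>z\<in>carrier G.
      f y \<le> ereal (p + \<delta>) \<longrightarrow> g z \<le> ereal (q + \<delta>) \<longrightarrow> d (y \<otimes> z) a \<le> \<epsilon>"
      using near_mult [OF \<epsilon>] by blast
    have "f y \<le> ereal (p + \<delta>)" "g z \<le> ereal (q + \<delta>)"
      using y(2) z(2) \<open>\<delta> > 0\<close> by simp_all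
    with \<delta> yz show ?thesis
      by blast
  qed
  then have "d (y \<otimes> z) a \<le> 0"
    using field_le_epsilon [of "d (y \<otimes> z) a" 0] by simp
  then have "d (y \<otimes> z) a = 0"
    by (intro antisym nonneg)
  then have "y \<otimes> z = a"
    using yz a by simp
  then show thesis
    using y(1) z(1) by (rule that)
qed

end

theorem theorem2:
  fixes G :: "('a, 'b) monoid_scheme"
    and d :: "'a \<Rightarrow> 'a \<Rightarrow> real"
    and f g :: "'a \<Rightarrow> ereal"
    and a :: 'a
  assumes "metric_invariant_group G d"
    and "Metric_space.mcomplete (carrier G) d"
    and "a \<in> carrier G"
    and "f \<in> carrier G \<rightarrow> {-\<infinity><..}"
    and "g \<in> carrier G \<rightarrow> {-\<infinity><..}"
    and "effective_domain (carrier G) f \<noteq> {}"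
    and "effective_domain (carrier G) g \<noteq> {}"
    and "lower_semicontinuous_map (Metric_space.mtopology (carrier G) d) f"
    and "lower_semicontinuous_map (Metric_space.mtopology (carrier G) d) g"
  shows "Metric_space.strong_minimum_at (carrier G) d (inf_convolution G f g) a \<longleftrightarrow>
    (\<exists>y \<in> carrier G. \<exists>z \<in> carrier G. y \<otimes>\<^bsub>G\<^esub> z = a \<and>
      Metric_space.strong_minimum_at (carrier G) d f y \<and>
      Metric_space.strong_minimum_at (carrier G) d g z)"
proof -
  interpret metric_invariant_group G d
    by fact
  show ?thesis
  proof
    assume "strong_minimum_at (inf_convolution G f g) a"
    then obtain y z where "y \<otimes>\<^bsub>G\<^esub> z = a" "strong_minimum_at f y" "strong_minimum_at g z"
      using strong_minimum_factors [OF assms(2,4,6,8,5,7,9)] by blast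
    then show "\<exists>y \<in> carrier G. \<exists>z \<in> carrier G. y \<otimes>\<^bsub>G\<^esub> z = a \<and>
        strong_minimum_at f y \<and> strong_minimum_at g z"
      by (blast dest: strong_minimum_at_imp_mem)
  qed (auto intro: strong_minimum_inf_convolution)
qed

end
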